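(* Let $W$ be a Coxeter group, i.e. $(W,S)$ is a Coxeter system with $S$ finite. Then the center $Z(W)$ of $W$ is finite and is isomorphic to $(\mathbb{Z}_2)^n$ for some integer $n\ge 0$.
   Context: A Coxeter group is a group $W$ having a presentation $\langle S \mid (st)^{m(s,t)}=1 \text{ for } s,t\in S\rangle$, where $S$ is a finite set and $m:S\times S\to \mathbb{N}\cup\{\infty\}$ satisfies: (1) $m(s,t)=m(t,s)$ for all $s,t\in S$; (2) $m(s,s)=1$ for all $s\in S$; (3) $m(s,t)\ge 2$ for all $s\ne t$ in $S$ (no relation is imposed when $m(s,t)=\infty$). The pair $(W,S)$ is called a Coxeter system. $Z(G)$ denotes the center of a group $G$, and $\mathbb{Z}_2$ is the cyclic group of order $2$. *)

theory Defs
  imports "HOL-Algebra.Algebra" "HOL-Library.Extended_Nat"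
begin

text \<open>
  A letter \<open>(s, True)\<close> is the generator \<open>s\<close>, and \<open>(s, False)\<close> is its formal inverse.
\<close>

type_synonym 's word = "('s \<times> bool) list"

abbreviation words :: "'s set \<Rightarrow> 's word set"
  where "words S \<equiv> lists (S \<times> UNIV)"

text \<open>
  Two words represent the same element of the group \<open>\<langle>S | R\<rangle>\<close> iff one is obtained from the
  other by inserting and deleting the trivial relators \<open>s s\<^sup>-\<^sup>1\<close>, \<open>s\<^sup>-\<^sup>1 s\<close> and the relators in \<open>R\<close>;
  equivalently, iff they agree in the free group on \<open>S\<close> modulo the normal closure of \<open>R\<close>.
\<close>

inductive word_equiv :: "'s set \<Rightarrow> 's word set \<Rightarrow> 's word \<Rightarrow> 's word \<Rightarrow> bool"
  for S :: "'s set" and R :: "'s word set"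
where
  refl: "w \<in> words S \<Longrightarrow> word_equiv S R w w"
| sym: "word_equiv S R u v \<Longrightarrow> word_equiv S R v u"
| trans: "word_equiv S R u v \<Longrightarrow> word_equiv S R v w \<Longrightarrow> word_equiv S R u w"
| cancel: "u \<in> words S \<Longrightarrow> v \<in> words S \<Longrightarrow> s \<in> S
    \<Longrightarrow> word_equiv S R (u @ [(s, b), (s, \<not> b)] @ v) (u @ v)"
| relator: "u \<in> words S \<Longrightarrow> v \<in> words S \<Longrightarrow> r \<in> R \<Longrightarrow> r \<in> words S
    \<Longrightarrow> word_equiv S R (u @ r @ v) (u @ v)"

definition word_class :: "'s set \<Rightarrow> 's word set \<Rightarrow> 's word \<Rightarrow> 's word set"
  where "word_class S R w = {v. word_equiv S R w v}"

definition presented_group :: "'s set \<Rightarrow> 's word set \<Rightarrow> 's word set monoid"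
  where "presented_group S R =
    \<lparr>carrier = word_class S R ` words S,
     monoid.mult = (\<lambda>A B. {w. \<exists>u\<in>A. \<exists>v\<in>B. word_equiv S R (u @ v) w}),
     one = word_class S R []\<rparr>"

text \<open>
  \<open>G\<close> has the presentation \<open>\<langle>S | R\<rangle>\<close> via \<open>gen\<close>, which interprets the generators in \<open>G\<close>.  The map
  \<open>gen\<close> is not assumed injective on \<open>S\<close>.  A presentation whose generators form a subset \<open>S\<close> of \<open>G\<close>
  is the case where \<open>gen\<close> is the identity.
\<close>

definition has_presentation ::
    "('g, 'b) monoid_scheme \<Rightarrow> 's set \<Rightarrow> ('s \<Rightarrow> 'g) \<Rightarrow> 's word set \<Rightarrow> bool"
  where "has_presentation G S gen R \<longleftrightarrow>
    group G \<and>
    (\<exists>h \<in> iso (presented_group S R) G. \<forall>s\<in>S. h (word_class S R [(s, True)]) = gen s)"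

definition coxeter_matrix :: "'s set \<Rightarrow> ('s \<Rightarrow> 's \<Rightarrow> enat) \<Rightarrow> bool"
  where "coxeter_matrix S m \<longleftrightarrow>
    (\<forall>s\<in>S. \<forall>t\<in>S. m s t = m t s) \<and>
    (\<forall>s\<in>S. m s s = 1) \<and>
    (\<forall>s\<in>S. \<forall>t\<in>S. s \<noteq> t \<longrightarrow> 2 \<le> m s t)"

definition coxeter_relators :: "'s set \<Rightarrow> ('s \<Rightarrow> 's \<Rightarrow> enat) \<Rightarrow> 's word set"
  where "coxeter_relators S m =
    {concat (replicate k [(s, True), (t, True)]) | s t k. s \<in> S \<and> t \<in> S \<and> m s t = enat k}"

definition coxeter_system :: "('w, 'b) monoid_scheme \<Rightarrow> 's set \<Rightarrow> ('s \<Rightarrow> 'w) \<Rightarrow> bool"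
  where "coxeter_system W S gen \<longleftrightarrow>
    finite S \<and> (\<exists>m. coxeter_matrix S m \<and> has_presentation W S gen (coxeter_relators S m))"

definition center :: "('g, 'b) monoid_scheme \<Rightarrow> 'g set"
  where "center G = {z \<in> carrier G. \<forall>x\<in>carrier G. z \<otimes>\<^bsub>G\<^esub> x = x \<otimes>\<^bsub>G\<^esub> z}"

lemma word_equiv_words:
  assumes "word_equiv S R u v"
  shows "u \<in> words S" "v \<in> words S"
  using assms by (induction rule: word_equiv.induct) auto

lemma word_equiv_append_left:
  assumes "word_equiv S R u v" "w \<in> words S"
  shows "word_equiv S R (w @ u) (w @ v)"
  using assms
proof (induction rule: word_equiv.induct)
  case (cancel u v s b)
  then show ?case using word_equiv.cancel[of "w @ u" S v s R b] by simp
next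
  case (relator u v r)
  then show ?case using word_equiv.relator[of "w @ u" S v r R] by simp
next
  case (refl x)
  then show ?case by (intro word_equiv.refl) simp
qed (blast intro: word_equiv.sym word_equiv.trans)+

lemma word_equiv_append_right:
  assumes "word_equiv S R u v" "w \<in> words S"
  shows "word_equiv S R (u @ w) (v @ w)"
  using assms
proof (induction rule: word_equiv.induct)
  case (cancel u v s b)
  then show ?case using word_equiv.cancel[of u S "v @ w" s R b] by simp
next
  case (relator u v r)
  then show ?case using word_equiv.relator[of u S "v @ w" r R] by simp
next
  case (refl x)
  then show ?case by (intro word_equiv.refl) simp
qed (blast intro: word_equiv.sym word_equiv.trans)+

lemma word_equiv_append:
  assumes "word_equiv S R u u'" "word_equiv S R v v'"
  shows "word_equiv S R (u @ v) (u' @ v')"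
  by (meson assms word_equiv.trans word_equiv_append_left word_equiv_append_right word_equiv_words)

lemma word_class_eq_iff:
  assumes "u \<in> words S"
  shows "word_class S R u = word_class S R v \<longleftrightarrow> word_equiv S R u v"
proof
  assume "word_class S R u = word_class S R v"
  moreover have "u \<in> word_class S R u"
    using assms by (simp add: word_class_def word_equiv.refl)
  ultimately have "word_equiv S R v u"
    by (simp add: word_class_def)
  then show "word_equiv S R u v"
    by (rule word_equiv.sym)
next
  assume "word_equiv S R u v"
  then show "word_class S R u = word_class S R v"
    unfolding word_class_def by (blast intro: word_equiv.sym word_equiv.trans)
qed

lemma mult_word_class:
  assumes "u \<in> words S" "v \<in> words S"
  shows "word_class S R u \<otimes>\<^bsub>presented_group S R\<^esub> word_class S R v = word_class S R (u @ v)"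
  unfolding presented_group_def word_class_def using assms
  by (auto intro: word_equiv.trans word_equiv_append word_equiv.refl)

lemma word_inverse:
  assumes "w \<in> words S"
  shows "\<exists>v\<in>words S. word_equiv S R (v @ w) []"
  using assms
proof (induction w)
  case Nil
  show ?case by (rule bexI[of _ "[]"]) (auto intro: word_equiv.refl)
next
  case (Cons a w)
  then obtain v where v: "v \<in> words S" "word_equiv S R (v @ w) []" by auto
  obtain s b where a: "a = (s, b)" by fastforce
  have sw: "s \<in> S" "w \<in> words S" using Cons.hyps a by auto
  have "word_equiv S R (v @ [(s, \<not> b), (s, \<not> \<not> b)] @ w) (v @ w)"
    using sw v(1) by (intro word_equiv.cancel)
  then have "word_equiv S R ((v @ [(s, \<not> b)]) @ a # w) []"
    using v(2) a by (auto intro: word_equiv.trans)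
  moreover have "v @ [(s, \<not> b)] \<in> words S" using sw v(1) by auto
  ultimately show ?case by blast
qed

lemma group_presented_group: "group (presented_group S R)"
proof (rule groupI)
  have carr: "carrier (presented_group S R) = word_class S R ` words S"
    and one: "\<one>\<^bsub>presented_group S R\<^esub> = word_class S R []"
    by (simp_all add: presented_group_def)
  show "\<one>\<^bsub>presented_group S R\<^esub> \<in> carrier (presented_group S R)"
    unfolding carr one by blast
  fix x assume "x \<in> carrier (presented_group S R)"
  then obtain u where u: "u \<in> words S" "x = word_class S R u" unfolding carr by blast
  show "\<one>\<^bsub>presented_group S R\<^esub> \<otimes>\<^bsub>presented_group S R\<^esub> x = x"
    using mult_word_class[of "[]" S u R] u unfolding one by simp
  show "\<exists>y\<in>carrier (presented_group S R). y \<otimes>\<^bsub>presented_group S R\<^esub> x = \<one>\<^bsub>presented_group S R\<^esub>"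
  proof -
    obtain v where v: "v \<in> words S" "word_equiv S R (v @ u) []"
      using word_inverse[OF u(1)] by blast
    then have "word_class S R (v @ u) = word_class S R []"
      using u(1) by (subst word_class_eq_iff) auto
    then show ?thesis using u v mult_word_class[of v S u R] unfolding carr one by auto
  qed
  fix y assume "y \<in> carrier (presented_group S R)"
  then obtain v where v: "v \<in> words S" "y = word_class S R v" unfolding carr by blast
  show "x \<otimes>\<^bsub>presented_group S R\<^esub> y \<in> carrier (presented_group S R)"
    using u v mult_word_class[of u S v R] unfolding carr by auto
  fix z assume "z \<in> carrier (presented_group S R)"
  then obtain w where w: "w \<in> words S" "z = word_class S R w" unfolding carr by blast
  show "x \<otimes>\<^bsub>presented_group S R\<^esub> y \<otimes>\<^bsub>presented_group S R\<^esub> z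
      = x \<otimes>\<^bsub>presented_group S R\<^esub> (y \<otimes>\<^bsub>presented_group S R\<^esub> z)"
    unfolding u(2) v(2) w(2)
    using mult_word_class[of _ S _ R] u(1) v(1) w(1) by simp
qed

lemma coxeter_system_presented_group:
  assumes "finite S" "coxeter_matrix S m"
  shows "coxeter_system (presented_group S (coxeter_relators S m)) S
    (\<lambda>s. word_class S (coxeter_relators S m) [(s, True)])"
  unfolding coxeter_system_def has_presentation_def
  using assms group_presented_group iso_set_refl by (metis id_apply)

end

theory Submission
  imports Defs
begin

text \<open>
  Letting a generator \<open>s\<close> act as the pair \<open>({s}, s)\<close> defines a cocycle \<open>N\<close> from \<open>W\<close> to the subsets
  of \<open>W\<close>, with \<open>N (v w)\<close> the symmetric difference of \<open>N v\<close> and \<open>v (N w) v\<^sup>-\<^sup>1\<close>.  The strong exchange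
  property shows that \<open>N w = {}\<close> only for \<open>w = 1\<close>.  On the centre \<open>N\<close> is additive, so every central
  \<open>z\<close> satisfies \<open>N (z\<^sup>2) = {}\<close>, that is \<open>z\<^sup>2 = 1\<close>.  Moreover \<open>N z\<close> consists of conjugates of generators
  and is invariant under conjugation, so it is determined by the generators in it, which leaves
  finitely many choices for \<open>z\<close>.
\<close>

section \<open>Finite groups of exponent two\<close>

lemma (in group) comm_group_if_involutive:
  assumes "\<And>x. x \<in> carrier G \<Longrightarrow> x \<otimes> x = \<one>"
  shows "comm_group G"
proof (rule group_comm_groupI)
  have inv_self: "inv x = x" if "x \<in> carrier G" for x
    using assms that by (simp add: inv_equality)
  fix x y assume "x \<in> carrier G" "y \<in> carrier G"
  then show "x \<otimes> y = y \<otimes> x"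
    using inv_self[of "x \<otimes> y"] inv_self[of x] inv_self[of y] by (simp add: inv_mult_group)
qed

text \<open>
  The \<open>n\<close> for which \<open>\<int>\<^sub>2\<^sup>n\<close> embeds are bounded, and an embedding which misses \<open>g\<close> extends to
  \<open>\<int>\<^sub>2\<^sup>n\<^sup>+\<^sup>1\<close> by sending the new coordinate to \<open>g\<close>.
\<close>

lemma (in group) iso_power_Z2_if_involutive:
  assumes fin: "finite (carrier G)"
    and sq: "\<And>x. x \<in> carrier G \<Longrightarrow> x \<otimes> x = \<one>"
  shows "\<exists>n::nat. G \<cong> product_group {..<n} (\<lambda>_. integer_mod_group 2)"
proof -
  interpret comm_group G using comm_group_if_involutive sq by blast
  define Z where "Z n = product_group {..<n::nat} (\<lambda>_. integer_mod_group 2)" for n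
  have carr: "carrier (Z n) = {..<n} \<rightarrow>\<^sub>E {0..<2}" for n
    by (simp add: Z_def carrier_integer_mod_group)
  have mult: "x \<otimes>\<^bsub>Z n\<^esub> y = (\<lambda>i\<in>{..<n}. (x i + y i) mod 2)" for n x y
    by (simp add: Z_def mult_integer_mod_group)
  have grp: "group (Z n)" for n
    by (simp add: Z_def)
  define P where "P n \<longleftrightarrow> (\<exists>h. h \<in> hom (Z n) G \<and> inj_on h (carrier (Z n)))" for n
  have P0: "P 0"
    unfolding P_def by (rule exI[of _ "\<lambda>_. \<one>"]) (auto simp: hom_def carr)
  have bound: "n < card (carrier G)" if "P n" for n
  proof -
    obtain h where h: "h \<in> hom (Z n) G" "inj_on h (carrier (Z n))"
      using \<open>P n\<close> by (auto simp: P_def)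
    have "2 ^ n = card (carrier (Z n))"
      by (simp add: carr card_PiE)
    also have "\<dots> \<le> card (carrier G)"
      using h fin by (intro card_inj_on_le) (auto simp: hom_def)
    finally show ?thesis
      using less_exp[of n] by linarith
  qed
  define n where "n = Greatest P"
  have Pn: "P n" and max: "\<And>k. P k \<Longrightarrow> k \<le> n"
    unfolding n_def using GreatestI_nat[of P, OF P0] Greatest_le_nat[of P] bound
    by (meson less_imp_le)+
  obtain h where h: "h \<in> hom (Z n) G" "inj_on h (carrier (Z n))"
    using Pn by (auto simp: P_def)
  have "carrier G \<subseteq> h ` carrier (Z n)"
  proof
    fix g assume g: "g \<in> carrier G"
    show "g \<in> h ` carrier (Z n)"
    proof (rule ccontr)
      assume miss: "g \<notin> h ` carrier (Z n)"
      \<comment> \<open>The extension \<open>h'\<close> splits a point into its first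
        \<open>n\<close> coordinates, read off by \<open>r\<close>, and its last one, which
        \<open>c\<close> sends to \<open>\<one>\<close> or \<open>g\<close>; \<open>c\<close>
        respects addition mod 2 because \<open>g \<otimes> g = \<one>\<close>.\<close>
      define r where "r x = restrict x {..<n}" for x :: "nat \<Rightarrow> int"
      define c where "c i = (if i = (0::int) then \<one> else g)" for i
      define h' where "h' x = h (r x) \<otimes> c (x n)" for x
      have r_in: "r x \<in> carrier (Z n)" if "x \<in> carrier (Z (Suc n))" for x
        using that by (auto simp: carr r_def PiE_def Pi_def)
      have last: "x n = 0 \<or> x n = 1" if "x \<in> carrier (Z (Suc n))" for x
      proof -
        have "x n \<in> {0..<2}" using that unfolding carr by (rule PiE_mem) simp
        then show ?thesis by auto
      qed
      have h_in: "h x \<in> carrier G" if "x \<in> carrier (Z n)" for x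
        using h(1) that by (auto simp: hom_def)
      have c_in: "c i \<in> carrier G" for i
        using g by (simp add: c_def)
      have r_mult: "r (x \<otimes>\<^bsub>Z (Suc n)\<^esub> y) = r x \<otimes>\<^bsub>Z n\<^esub> r y" for x y
        by (auto simp: mult r_def restrict_def)
      have c_mult: "c ((i + j) mod 2) = c i \<otimes> c j" if "i = 0 \<or> i = 1" "j = 0 \<or> j = 1" for i j
        using that g sq by (auto simp: c_def)
      have "h' \<in> hom (Z (Suc n)) G"
      proof (rule homI)
        fix x y assume x: "x \<in> carrier (Z (Suc n))" and y: "y \<in> carrier (Z (Suc n))"
        show "h' x \<in> carrier G"
          using x by (simp add: h'_def h_in r_in c_in)
        have "h' (x \<otimes>\<^bsub>Z (Suc n)\<^esub> y) = (h (r x) \<otimes> h (r y)) \<otimes> (c (x n) \<otimes> c (y n))"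
          using hom_mult[OF h(1) r_in[OF x] r_in[OF y]] c_mult[OF last[OF x] last[OF y]]
          by (simp add: h'_def r_mult) (simp add: mult)
        then show "h' (x \<otimes>\<^bsub>Z (Suc n)\<^esub> y) = h' x \<otimes> h' y"
          using x y by (simp add: h'_def h_in r_in c_in m_ac)
      qed
      moreover have "inj_on h' (carrier (Z (Suc n)))"
      proof (rule inj_onI)
        fix x y assume x: "x \<in> carrier (Z (Suc n))" and y: "y \<in> carrier (Z (Suc n))"
          and eq: "h' x = h' y"
        have diff: "h (r y) \<otimes> h (r x) = h (r y \<otimes>\<^bsub>Z n\<^esub> r x)"
          "r y \<otimes>\<^bsub>Z n\<^esub> r x \<in> carrier (Z n)"
          using hom_mult[OF h(1) r_in[OF y] r_in[OF x]]
            monoid.m_closed[OF group.is_monoid[OF grp] r_in[OF y] r_in[OF x]] by simp_all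
        have cancel: "h (r y) \<otimes> (h (r y) \<otimes> g) = g" "h (r x) \<otimes> (h (r x) \<otimes> g) = g"
          using sq x y g by (simp_all add: h_in r_in flip: m_assoc)
        \<comment> \<open>If the last coordinates differed, exactly one side of
          \<open>h' x = h' y\<close> would carry the factor \<open>g\<close>. Solving for
          \<open>g\<close> would place it in the image of \<open>h\<close>.\<close>
        have "x n = y n"
        proof (rule ccontr)
          assume "x n \<noteq> y n"
          then have "h (r x) \<otimes> g = h (r y) \<or> h (r y) \<otimes> g = h (r x)"
            using last[OF x] last[OF y] eq x y by (auto simp: h'_def c_def h_in r_in)
          then have "g = h (r y) \<otimes> h (r x)"
            using cancel x y by (metis h_in r_in m_comm)
          then show False
            using diff miss by auto
        qed
        then have r_eq: "r x = r y"
          using eq x y h(2) c_in by (auto simp: h'_def h_in r_in dest: inj_onD)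
        have "x i = y i" if "i \<in> {..<Suc n}" for i
        proof (cases "i = n")
          case False
          then have "x i = r x i" "y i = r y i" using that by (simp_all add: r_def)
          then show ?thesis using r_eq by simp
        qed (simp add: \<open>x n = y n\<close>)
        then show "x = y"
          using x y unfolding carr by (rule PiE_ext[rotated 2])
      qed
      ultimately have "P (Suc n)" unfolding P_def by blast
      then show False using max by fastforce
    qed
  qed
  then have "h \<in> iso (Z n) G"
    using h by (auto simp: iso_def bij_betw_def dest: hom_carrier)
  then have "G \<cong> Z n"
    using group.iso_sym[OF grp] by (auto simp: is_iso_def)
  then show ?thesis by (auto simp: Z_def)
qed

section \<open>The centre as a subgroup\<close>

lemma center_closed: "z \<in> center G \<Longrightarrow> z \<in> carrier G"
  by (simp add: center_def)

lemma center_commute: "z \<in> center G \<Longrightarrow> x \<in> carrier G \<Longrightarrow> z \<otimes>\<^bsub>G\<^esub> x = x \<otimes>\<^bsub>G\<^esub> z"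
  by (simp add: center_def)

lemma (in group) subgroup_center: "subgroup (center G) G"
proof (rule subgroupI)
  show "center G \<subseteq> carrier G" "center G \<noteq> {}"
    by (auto simp: center_def intro!: exI[of _ \<one>])
next
  fix a assume a: "a \<in> center G"
  show "inv a \<in> center G"
    unfolding center_def
  proof (intro CollectI conjI ballI)
    show "inv a \<in> carrier G" using a by (simp add: center_def)
    fix x assume x: "x \<in> carrier G"
    have carr: "a \<in> carrier G" and comm: "a \<otimes> x = x \<otimes> a" using a x center_closed center_commute by metis+
    have "inv a \<otimes> x = inv a \<otimes> (x \<otimes> a) \<otimes> inv a" using x carr by (simp add: m_assoc)
    also have "\<dots> = x \<otimes> inv a" unfolding comm[symmetric] using x carr by (simp flip: m_assoc)
    finally show "inv a \<otimes> x = x \<otimes> inv a" .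
  qed
next
  fix a b assume a: "a \<in> center G" and b: "b \<in> center G"
  have "a \<otimes> b \<otimes> x = x \<otimes> (a \<otimes> b)" if x: "x \<in> carrier G" for x
  proof -
    have carr: "a \<in> carrier G" "b \<in> carrier G" and comm: "a \<otimes> x = x \<otimes> a" "b \<otimes> x = x \<otimes> b"
      using a b x center_closed center_commute by metis+
    have "a \<otimes> b \<otimes> x = a \<otimes> x \<otimes> b" using carr x comm(2) by (simp add: m_assoc)
    also have "\<dots> = x \<otimes> (a \<otimes> b)" using carr x comm(1) by (simp add: m_assoc)
    finally show ?thesis .
  qed
  moreover have "a \<otimes> b \<in> carrier G" using a b by (simp add: center_closed)
  ultimately show "a \<otimes> b \<in> center G" unfolding center_def by blast
qed

text \<open>These rules would unfold \<open>w \<in> words S\<close> into a statement about \<open>set w\<close>.\<close>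

declare in_listsD [rule del] in_listsI [rule del]

section \<open>Words in the generators and their values\<close>

locale coxeter = group W for W (structure) +
  fixes S :: "'s set" and gen :: "'s \<Rightarrow> 'a" and m :: "'s \<Rightarrow> 's \<Rightarrow> enat"
  assumes finite_S: "finite S"
    and matrix: "coxeter_matrix S m"
    and presentation: "has_presentation W S gen (coxeter_relators S m)"
begin

text \<open>Generators are involutions, so \<open>ev\<close> and \<open>N\<close> ignore the signs of the letters.\<close>

fun ev :: "'s word \<Rightarrow> 'a" where
  "ev [] = \<one>"
| "ev (a # w) = gen (fst a) \<otimes> ev w"

fun N :: "'s word \<Rightarrow> 'a \<Rightarrow> bool" where
  "N [] x \<longleftrightarrow> False"
| "N (a # w) x \<longleftrightarrow> (x = gen (fst a)) \<noteq> N w (gen (fst a) \<otimes> x \<otimes> gen (fst a))"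

text \<open>The diagonal entry \<open>m s s = 1\<close> makes \<open>s s\<close> itself a
  relator.\<close>

lemma square_equiv_Nil:
  assumes "s \<in> S" "u \<in> words S" "v \<in> words S"
  shows "word_equiv S (coxeter_relators S m) (u @ [(s, True), (s, True)] @ v) (u @ v)"
proof (rule word_equiv.relator)
  have "m s s = enat 1" using assms matrix by (simp add: coxeter_matrix_def one_enat_def)
  then show "[(s, True), (s, True)] \<in> coxeter_relators S m"
    using assms unfolding coxeter_relators_def
    by (intro CollectI exI[of _ s] exI[of _ "1::nat"]) simp
qed (use assms in auto)

text \<open>Identifies the isomorphism supplied by the presentation with \<open>ev\<close>, so that
  its bijectivity yields both the surjectivity of \<open>ev\<close> and the description of its
  fibres.\<close>

lemma ev_presentation:
  obtains h where "h \<in> iso (presented_group S (coxeter_relators S m)) W"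
    and "\<And>w. w \<in> words S \<Longrightarrow> h (word_class S (coxeter_relators S m) w) = ev w"
    and "\<And>s. s \<in> S \<Longrightarrow> gen s \<in> carrier W"
proof -
  let ?R = "coxeter_relators S m"
  let ?P = "presented_group S ?R"
  obtain h where h: "h \<in> iso ?P W" and gen: "\<And>s. s \<in> S \<Longrightarrow> h (word_class S ?R [(s, True)]) = gen s"
    using presentation by (auto simp: has_presentation_def)
  have hom: "h \<in> hom ?P W" using h by (simp add: iso_def)
  have in_P: "word_class S ?R w \<in> carrier ?P" if "w \<in> words S" for w
    using that by (simp add: presented_group_def)
  \<comment> \<open>The word \<open>s^-1 s s\<close> reduces to \<open>s^-1\<close> by the relator
    \<open>s s\<close> and to \<open>s\<close> by free cancellation.\<close>
  have "word_class S ?R [(s, False)] = word_class S ?R [(s, True)]" if s: "s \<in> S" for s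
  proof -
    have "word_equiv S ?R [(s, False), (s, True), (s, True)] [(s, False)]"
      using square_equiv_Nil[OF s, of "[(s, False)]" "[]"] s by simp
    moreover have "word_equiv S ?R [(s, False), (s, True), (s, True)] [(s, True)]"
      using word_equiv.cancel[of "[]" S "[(s, True)]" s ?R False] s by simp
    ultimately show ?thesis
      using s by (subst word_class_eq_iff) (auto intro: word_equiv.trans word_equiv.sym)
  qed
  then have letter: "h (word_class S ?R [(s, b)]) = gen s" if "s \<in> S" for s b
    using gen that by (cases b) auto
  have "h (word_class S ?R w) = ev w" if "w \<in> words S" for w
    using that
  proof (induction w)
    case Nil
    have "h \<one>\<^bsub>?P\<^esub> = \<one>"
      using hom_one[OF hom group_presented_group is_group] .
    then show ?case by (simp add: presented_group_def)
  next
    case (Cons a w)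
    obtain s b where a: "a = (s, b)" by fastforce
    have s: "[(s, b)] \<in> words S" "w \<in> words S" "s \<in> S" using Cons.hyps a by auto
    show ?case
      using hom_mult[OF hom in_P[OF s(1)] in_P[OF s(2)]] mult_word_class[OF s(1,2), of ?R]
        letter[OF s(3)] Cons.IH a by simp
  qed
  moreover have "gen s \<in> carrier W" if "s \<in> S" for s
    using gen[OF that] hom in_P[of "[(s, True)]"] that by (force simp: hom_def)
  ultimately show ?thesis using that h by blast
qed

lemma gen_closed [simp]: "s \<in> S \<Longrightarrow> gen s \<in> carrier W"
  using ev_presentation by metis

lemma ev_closed [simp]: "w \<in> words S \<Longrightarrow> ev w \<in> carrier W"
  by (induction w) auto

lemma ev_append: "u \<in> words S \<Longrightarrow> v \<in> words S \<Longrightarrow> ev (u @ v) = ev u \<otimes> ev v"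
  by (induction u) (auto simp: m_assoc)

lemma ev_surj:
  assumes "x \<in> carrier W"
  obtains w where "w \<in> words S" "ev w = x"
proof -
  obtain h where h: "h \<in> iso (presented_group S (coxeter_relators S m)) W"
    and ev: "\<And>w. w \<in> words S \<Longrightarrow> h (word_class S (coxeter_relators S m) w) = ev w"
    using ev_presentation by metis
  have "x \<in> h ` word_class S (coxeter_relators S m) ` words S"
    using h assms by (simp add: iso_def bij_betw_def presented_group_def)
  then obtain w where "w \<in> words S" "x = h (word_class S (coxeter_relators S m) w)"
    by blast
  then show ?thesis using that ev by simp
qed

lemma word_equiv_iff_ev_eq:
  assumes "u \<in> words S" "v \<in> words S"
  shows "word_equiv S (coxeter_relators S m) u v \<longleftrightarrow> ev u = ev v"
proof -
  obtain h where h: "h \<in> iso (presented_group S (coxeter_relators S m)) W"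
    and ev: "\<And>w. w \<in> words S \<Longrightarrow> h (word_class S (coxeter_relators S m) w) = ev w"
    using ev_presentation by metis
  have "inj_on h (word_class S (coxeter_relators S m) ` words S)"
    using h by (simp add: iso_def bij_betw_def presented_group_def)
  then have "word_class S (coxeter_relators S m) u = word_class S (coxeter_relators S m) v
      \<longleftrightarrow> ev u = ev v"
    unfolding ev[OF assms(1), symmetric] ev[OF assms(2), symmetric]
    using assms by (simp add: inj_on_eq_iff)
  then show ?thesis using word_class_eq_iff[OF assms(1)] by simp
qed

lemma gen_square [simp]: "s \<in> S \<Longrightarrow> gen s \<otimes> gen s = \<one>"
  using square_equiv_Nil[of s "[]" "[]"]
    word_equiv_iff_ev_eq[of "[(s, True), (s, True)]" "[]"] by simp

lemma gen_cancel [simp]: "s \<in> S \<Longrightarrow> x \<in> carrier W \<Longrightarrow> gen s \<otimes> (gen s \<otimes> x) = x"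
  by (simp flip: m_assoc)

lemma inv_gen [simp]: "s \<in> S \<Longrightarrow> inv (gen s) = gen s"
  by (simp add: inv_equality)

section \<open>The cocycle on words and its invariance under the relations\<close>

lemma conj_eq_iff:
  assumes "x \<in> carrier W" "y \<in> carrier W" "g \<in> carrier W"
  shows "inv g \<otimes> x \<otimes> g = y \<longleftrightarrow> x = g \<otimes> y \<otimes> inv g"
  using assms by (metis inv_closed inv_solve_left inv_solve_right m_assoc m_closed)

text \<open>The cocycle rule, with \<open>\<noteq>\<close> on truth values as symmetric difference.
  Reading a letter conjugates the tested point by it, so after \<open>u\<close> the point has been
  conjugated by \<open>ev u\<close>.\<close>

lemma N_append:
  assumes "u \<in> words S" "v \<in> words S" "x \<in> carrier W"
  shows "N (u @ v) x \<longleftrightarrow> N u x \<noteq> N v (inv (ev u) \<otimes> x \<otimes> ev u)"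
  using assms
proof (induction u arbitrary: x)
  case (Cons a u)
  then have a: "fst a \<in> S" "u \<in> words S" by auto
  then show ?case
    using Cons by (auto simp: inv_mult_group m_assoc)
qed simp

lemma ev_relator:
  assumes "s \<in> S" "t \<in> S"
  shows "ev (concat (replicate k [(s, True), (t, True)])) = (gen s \<otimes> gen t) [^] k"
  using assms by (induction k) (auto simp: nat_pow_Suc2 m_assoc simp del: nat_pow_Suc Group.nat_pow_Suc)

text \<open>Dihedral computation: conjugation by \<open>gen s\<close> inverts
  \<open>gen s \<otimes> gen t\<close>, so the inverse power passes \<open>gen s\<close> as the
  power itself.\<close>

lemma gen_pow_gen:
  assumes "s \<in> S" "t \<in> S"
  shows "(gen s \<otimes> gen t) [^] (k::nat) \<otimes> gen s \<otimes> inv ((gen s \<otimes> gen t) [^] k)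
    = (gen s \<otimes> gen t) [^] (2 * k) \<otimes> gen s"
proof -
  let ?p = "gen s \<otimes> gen t"
  have "gen s \<otimes> inv (?p [^] k) = ?p [^] k \<otimes> gen s"
  proof (induction k)
    case (Suc k)
    have "gen s \<otimes> inv (?p [^] Suc k) = gen s \<otimes> inv (?p [^] k \<otimes> ?p)" by simp
    also have "\<dots> = gen s \<otimes> (gen t \<otimes> (gen s \<otimes> inv (?p [^] k)))"
      using assms by (simp add: inv_mult_group m_assoc)
    also have "\<dots> = ?p \<otimes> ?p [^] k \<otimes> gen s"
      using assms Suc by (simp add: m_assoc)
    finally show ?case
      using assms by (simp add: nat_pow_Suc2 del: nat_pow_Suc Group.nat_pow_Suc)
  qed (use assms in simp)
  then show ?thesis
    using assms by (simp add: m_assoc mult_2 flip: nat_pow_mult)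
qed

text \<open>The letter at position \<open>i\<close>, counted from 0, contributes the reflection
  \<open>(gen s \<otimes> gen t) [^] i \<otimes> gen s\<close>, and \<open>N\<close> records the
  parity of the hits.\<close>

lemma N_relator_parity:
  assumes "s \<in> S" "t \<in> S" "x \<in> carrier W"
  shows "N (concat (replicate k [(s, True), (t, True)])) x
    \<longleftrightarrow> odd (\<Sum>i<2*k. of_bool (x = (gen s \<otimes> gen t) [^] i \<otimes> gen s) :: nat)"
proof (induction k)
  case (Suc k)
  let ?p = "gen s \<otimes> gen t"
  let ?w = "\<lambda>k. concat (replicate k [(s, True), (t, True)])"
  let ?q = "?p [^] k"
  let ?y = "inv ?q \<otimes> x \<otimes> ?q"
  have w: "?w k \<in> words S" using assms by (induction k) auto
  have snoc: "?w (Suc k) = ?w k @ [(s, True), (t, True)]"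
    by (induction k) auto
  have y: "?y = gen s \<longleftrightarrow> x = ?p [^] (2 * k) \<otimes> gen s"
    using assms conj_eq_iff[of x "gen s" ?q] gen_pow_gen[OF assms(1,2), of k] by simp
  \<comment> \<open>The second letter of the new pair is tested after a further conjugation by
    \<open>gen s\<close>; it accounts for the index \<open>2 * k + 1\<close>.\<close>
  have "gen s \<otimes> ?y \<otimes> gen s = gen t \<longleftrightarrow> ?y = gen s \<otimes> gen t \<otimes> gen s"
    using assms conj_eq_iff[of ?y "gen t" "gen s"] by simp
  also have "\<dots> \<longleftrightarrow> x = ?q \<otimes> (?p \<otimes> gen s) \<otimes> inv ?q"
    using assms conj_eq_iff[of x "?p \<otimes> gen s" ?q] by simp
  \<comment> \<open>\<open>?p\<close> commutes with its power \<open>?q\<close>.\<close>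
  also have "?q \<otimes> (?p \<otimes> gen s) \<otimes> inv ?q = ?p \<otimes> (?q \<otimes> gen s \<otimes> inv ?q)"
    using assms nat_pow_Suc2[of ?p k] by (simp flip: m_assoc)
  also have "\<dots> = ?p [^] Suc (2 * k) \<otimes> gen s"
    using assms gen_pow_gen[OF assms(1,2), of k] nat_pow_Suc2[of ?p "2 * k"]
    by (simp add: m_assoc del: nat_pow_Suc Group.nat_pow_Suc)
  finally have y': "gen s \<otimes> ?y \<otimes> gen s = gen t \<longleftrightarrow> x = ?p [^] Suc (2 * k) \<otimes> gen s" .
  have "N (?w (Suc k)) x
    \<longleftrightarrow> N (?w k) x \<noteq> ((?y = gen s) \<noteq> (gen s \<otimes> ?y \<otimes> gen s = gen t))"
    unfolding snoc using assms w by (subst N_append) (auto simp: ev_relator)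
  then show ?case
    unfolding Suc y y' by (simp del: nat_pow_Suc Group.nat_pow_Suc)
qed simp

text \<open>Since the \<open>k\<close>-th power of \<open>gen s \<otimes> gen t\<close> is trivial,
  the \<open>2 * k\<close> reflections of the relator run twice through the same \<open>k\<close>
  terms, so every point is hit an even number of times.\<close>

lemma N_relator:
  assumes "r \<in> coxeter_relators S m" "x \<in> carrier W"
  shows "r \<in> words S" "ev r = \<one>" "\<not> N r x"
proof -
  obtain s t k where r: "r = concat (replicate k [(s, True), (t, True)])" and st: "s \<in> S" "t \<in> S"
    using assms by (auto simp: coxeter_relators_def)
  show words: "r \<in> words S" unfolding r using st by (induction k) auto
  then have "word_equiv S (coxeter_relators S m) r []"
    using word_equiv.relator[of "[]" S "[]" r "coxeter_relators S m"] assms by simp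
  then show ev: "ev r = \<one>"
    using words by (simp add: word_equiv_iff_ev_eq)
  let ?p = "gen s \<otimes> gen t"
  let ?f = "\<lambda>i. of_bool (x = ?p [^] i \<otimes> gen s) :: nat"
  have "?p [^] k = \<one>" using ev ev_relator[OF st] r by simp
  then have periodic: "?p [^] (i + k) = ?p [^] i" for i
    using st by (simp flip: nat_pow_mult)
  have "sum ?f {..<k + n} = sum ?f {..<k} + (\<Sum>i<n. ?f (i + k))" for n
    by (induction n) (simp_all add: add_ac)
  then have "sum ?f {..<2 * k} = sum ?f {..<k} + (\<Sum>i<k. ?f (i + k))"
    by (simp only: mult_2)
  also have "\<dots> = 2 * sum ?f {..<k}"
    by (simp only: periodic mult_2)
  finally show "\<not> N r x"
    unfolding r using N_relator_parity[OF st assms(2), of k] by simp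
qed

text \<open>An inserted piece has value \<open>\<one>\<close> and empty \<open>N\<close>, so by the
  cocycle rule it does not affect the rest. For a cancelling pair, both letters contribute
  \<open>gen s\<close>.\<close>

lemma N_cong_word_equiv:
  assumes "word_equiv S (coxeter_relators S m) u v" "x \<in> carrier W"
  shows "N u x = N v x"
  using assms
proof (induction arbitrary: x rule: word_equiv.induct)
  case (cancel u v s b)
  let ?c = "[(s, b), (s, \<not> b)]"
  have c: "?c \<in> words S" using cancel by simp
  have self_conj: "gen s \<otimes> y \<otimes> gen s = gen s \<longleftrightarrow> y = gen s" if "y \<in> carrier W" for y
    using conj_eq_iff[of y "gen s" "gen s"] cancel that by (simp add: m_assoc)
  have not_c: "\<not> N ?c y" if "y \<in> carrier W" for y
    using self_conj[OF that] by auto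
  let ?y = "inv (ev u) \<otimes> x \<otimes> ev u"
  have "?y \<in> carrier W" using cancel by simp
  moreover have "ev ?c = \<one>" using cancel by simp
  ultimately have "N (?c @ v) ?y = N v ?y"
    using N_append[OF c cancel(2)] not_c by (simp del: ev.simps)
  then show ?case
    using cancel N_append[of u "?c @ v" x] N_append[of u v x] by (simp del: N.simps)
next
  case (relator u v r)
  then show ?case
    using N_append[of u "r @ v" x] N_append[of u v x] N_append[of r v] N_relator[OF relator(3)]
    by simp
qed simp_all

lemma N_cong:
  assumes "ev u = ev v" "u \<in> words S" "v \<in> words S" "x \<in> carrier W"
  shows "N u x = N v x"
  using assms N_cong_word_equiv word_equiv_iff_ev_eq by blast

section \<open>Strong exchange\<close>

text \<open>If \<open>N w x\<close> holds, some letter of \<open>w\<close> equals the conjugate of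
  \<open>x\<close> tested there. Deleting that letter multiplies \<open>ev w\<close> by
  \<open>x\<close> on the left.\<close>

lemma strong_exchange:
  assumes "w \<in> words S" "x \<in> carrier W" "N w x"
  shows "\<exists>v\<in>words S. length v < length w \<and> ev v = x \<otimes> ev w"
  using assms
proof (induction w arbitrary: x)
  case (Cons a w)
  let ?s = "gen (fst a)"
  have a: "fst a \<in> S" "w \<in> words S" using Cons.hyps by auto
  show ?case
  proof (cases "x = ?s")
    case True
    then show ?thesis using a by (intro bexI[of _ w]) auto
  next
    case False
    then have "N w (?s \<otimes> x \<otimes> ?s)" using Cons.prems by simp
    then obtain v where v: "v \<in> words S" "length v < length w" "ev v = ?s \<otimes> x \<otimes> ?s \<otimes> ev w"
      using Cons.IH[of "?s \<otimes> x \<otimes> ?s"] Cons.prems a by auto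
    show ?thesis
      using v a Cons.prems Cons.hyps by (intro bexI[of _ "a # v"]) (auto simp: m_assoc)
  qed
qed simp

text \<open>A shortest word \<open>u\<close> for the element must be empty: otherwise exchange
  applied to its tail would give a shorter word for the same element.\<close>

lemma ev_eq_one:
  assumes "w \<in> words S" "\<And>x. x \<in> carrier W \<Longrightarrow> \<not> N w x"
  shows "ev w = \<one>"
proof -
  obtain u where u: "u \<in> words S" "ev u = ev w"
    and min: "\<And>v. v \<in> words S \<Longrightarrow> ev v = ev w \<Longrightarrow> length u \<le> length v"
    using ex_has_least_nat[of "\<lambda>u. u \<in> words S \<and> ev u = ev w" w length] assms(1) by auto
  show ?thesis
  proof (cases u)
    case (Cons a v)
    let ?s = "gen (fst a)"
    have a: "fst a \<in> S" "v \<in> words S" using u Cons by auto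
    have "\<not> N u ?s" using N_cong[OF u(2,1) assms(1)] assms(2) a by auto
    \<comment> \<open>The first letter already contributes \<open>?s\<close>, so the tail must
      contribute it once more to cancel it.\<close>
    then have "N v ?s" using a Cons by (simp add: m_assoc)
    then obtain v' where v': "v' \<in> words S" "length v' < length v" "ev v' = ?s \<otimes> ev v"
      using strong_exchange[of v ?s] a by auto
    then have "length u \<le> length v'"
      using u(2) Cons by (intro min) simp_all
    then show ?thesis using v'(2) Cons by simp
  qed (use u in simp)
qed

section \<open>Central elements\<close>

lemma central_conj:
  assumes "z \<in> center W" "x \<in> carrier W"
  shows "inv z \<otimes> x \<otimes> z = x"
  using center_closed[OF assms(1)] assms(2) center_commute[OF assms]
    inv_solve_left'[of x z "x \<otimes> z"] by (simp add: m_assoc)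

lemma central_square:
  assumes "z \<in> center W"
  shows "z \<otimes> z = \<one>"
proof -
  obtain w where w: "w \<in> words S" "ev w = z"
    using ev_surj[OF center_closed[OF assms]] by blast
  have "ev (w @ w) = \<one>"
    using w assms by (intro ev_eq_one) (auto simp: N_append central_conj)
  then show ?thesis using w by (simp add: ev_append)
qed

text \<open>The words \<open>s u\<close> and \<open>u s\<close> have the same value. Expanding
  \<open>N\<close> of both, the letter \<open>s\<close> contributes the test
  \<open>x = gen s\<close> each time, as conjugation by the central \<open>ev u\<close> is trivial;
  cancelling it leaves the claim.\<close>

lemma N_central_conj_gen:
  assumes "u \<in> words S" "ev u \<in> center W" "s \<in> S" "x \<in> carrier W"
  shows "N u (gen s \<otimes> x \<otimes> gen s) = N u x"
proof -
  let ?s = "[(s, True)]"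
  have s: "?s \<in> words S" using assms by simp
  have "ev (?s @ u) = ev (u @ ?s)"
    using assms center_commute[OF assms(2), of "gen s"] by (simp add: ev_append)
  then have "N (?s @ u) x = N (u @ ?s) x"
    using N_cong assms s by (metis append_in_lists_conv)
  then show ?thesis
    using N_append[OF assms(1) s assms(4)] central_conj[OF assms(2,4)] by auto
qed

lemma N_central_eqI:
  assumes uv: "u \<in> words S" "ev u \<in> center W" "v \<in> words S" "ev v \<in> center W"
    and eq: "\<And>s. s \<in> S \<Longrightarrow> N u (gen s) = N v (gen s)"
    and "x \<in> carrier W"
  shows "N u x = N v x"
proof -
  text \<open>Points in some \<open>N w\<close> are conjugates of generators: induct on that \<open>w\<close>.\<close>
  have "N u x = N v x" if "w \<in> words S" "N w x" "x \<in> carrier W" for w x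
    using that
  proof (induction w arbitrary: x)
    case (Cons a w)
    let ?s = "gen (fst a)"
    have a: "fst a \<in> S" "w \<in> words S" using Cons.hyps by auto
    show ?case
    proof (cases "x = ?s")
      case False
      then have "N u (?s \<otimes> x \<otimes> ?s) = N v (?s \<otimes> x \<otimes> ?s)"
        using Cons a by auto
      then show ?thesis using N_central_conj_gen uv a Cons.prems by simp
    qed (use eq a in simp)
  qed simp
  \<comment> \<open>Take \<open>w\<close> to be \<open>u\<close> or \<open>v\<close>; where both
    fail to hold at \<open>x\<close>, they agree anyway.\<close>
  then show ?thesis using assms by blast
qed

lemma finite_center: "finite (center W)"
proof -
  define word where "word z = (SOME w. w \<in> words S \<and> ev w = z)" for z
  have word: "word z \<in> words S" "ev (word z) = z" if "z \<in> center W" for z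
  proof -
    have "\<exists>w. w \<in> words S \<and> ev w = z" using ev_surj[OF center_closed[OF that]] by blast
    then have "word z \<in> words S \<and> ev (word z) = z" unfolding word_def by (rule someI_ex)
    then show "word z \<in> words S" "ev (word z) = z" by auto
  qed
  define D where "D z = {s \<in> S. N (word z) (gen s)}" for z
  have "inj_on D (center W)"
  proof (rule inj_onI)
    fix y z assume y: "y \<in> center W" and z: "z \<in> center W" and "D y = D z"
    then have "N (word y) (gen s) = N (word z) (gen s)" if "s \<in> S" for s
      using that by (auto simp: D_def)
    then have N_eq: "N (word y) x = N (word z) x" if "x \<in> carrier W" for x
      using N_central_eqI[of "word y" "word z" x] word[OF y] word[OF z] y z that by simp
    \<comment> \<open>Conjugation by \<open>y\<close> is trivial, so two equal contributions
      cancel.\<close>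
    have "N (word y @ word z) x \<longleftrightarrow> False" if "x \<in> carrier W" for x
      using N_append[OF word(1)[OF y] word(1)[OF z] that] N_eq[OF that] word(2)[OF y]
        central_conj[OF y that] by simp
    then have "ev (word y @ word z) = \<one>"
      using word[OF y] word[OF z] by (intro ev_eq_one) auto
    \<comment> \<open>Both products are \<open>\<one>\<close>.\<close>
    then have "y \<otimes> z = z \<otimes> z"
      using ev_append[of "word y" "word z"] word[OF y] word[OF z] central_square[OF z] by simp
    then show "y = z" using y z by (simp add: center_closed)
  qed
  moreover have "D ` center W \<subseteq> Pow S" by (auto simp: D_def)
  ultimately show ?thesis
    using finite_S by (meson finite_Pow_iff inj_on_finite)
qed

end

theorem theorem1p1:
  fixes W :: "('w, 'b) monoid_scheme" and S :: "'s set" and gen :: "'s \<Rightarrow> 'w"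
  assumes "coxeter_system W S gen"
  shows "finite (center W) \<and>
    (\<exists>n::nat. W\<lparr>carrier := center W\<rparr> \<cong> product_group {..<n} (\<lambda>_. integer_mod_group 2))"
proof -
  obtain m where m: "finite S" "coxeter_matrix S m" "has_presentation W S gen (coxeter_relators S m)"
    using assms by (auto simp: coxeter_system_def)
  then interpret coxeter W S gen m
    by (simp add: coxeter_def coxeter_axioms_def has_presentation_def)
  interpret Z: group "W\<lparr>carrier := center W\<rparr>"
    using subgroup.subgroup_is_group[OF subgroup_center is_group] .
  show ?thesis
    using finite_center Z.iso_power_Z2_if_involutive central_square by simp
qed

end
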